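(* Let $R$ be a $J_{2,1}$ ring. Then $R$ is an elementary divisor ring iff it is a $\Pi_2$ ring. (Thus each $J_{2,1}$ ring which is an integral domain is an elementary divisor ring.)
   Context: Rings are commutative with identity. $R$ is a $J_{2,1}$ ring if for each $(a,b,c,d,\alpha,\Delta)\in R^6$ such that the equation $ax+by+cz+dw=\alpha$ in the indeterminates $x,y,z,w$ has a solution in $R^4$, this equation has a solution in $R^4$ with $xy-zw=\Delta$. $R$ is a $\Pi_2$ ring if for each $A\in\mathbb{M}_2(R)$ whose entries generate the unit ideal and with $\det(A)=0$, there exists $A^+\in SL_3(R)$ whose upper-left $2\times 2$ block is $A$. $R$ is an elementary divisor ring if for all $m,n\ge 1$ each $m\times n$ matrix over $R$ is equivalent (via multiplication by invertible matrices on the left and right) to a matrix whose off-diagonal entries are $0$ and whose diagonal entries $a_{1,1},\ldots,a_{s,s}$, $s=\min\{m,n\}$, satisfy $a_{i,i}\mid a_{i+1,i+1}$ for $1\le i\le s-1$. *)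

theory Defs
  imports "Jordan_Normal_Form.Determinant"
begin

text \<open>
  Rings are types of class \<^class>\<open>comm_ring_1\<close>; a property of the whole ring is a predicate on
  the type token, as in \<open>J21_ring TYPE('a)\<close>.
  Matrices are those of \<open>Jordan_Normal_Form\<close>, indexed from \<open>0\<close>.
\<close>

definition J21_ring :: "'a::comm_ring_1 itself \<Rightarrow> bool" where
  "J21_ring (_ :: 'a itself) \<longleftrightarrow>
     (\<forall>a b c d \<alpha> \<Delta> :: 'a.
        (\<exists>x y z w. a * x + b * y + c * z + d * w = \<alpha>) \<longrightarrow>
        (\<exists>x y z w. a * x + b * y + c * z + d * w = \<alpha> \<and> x * y - z * w = \<Delta>))"

text \<open>
  The ideal generated by a set is its span when the ring is regarded as a module over itself.
\<close>

lemma module_over_itself: "Modules.module ((*) :: 'a::comm_ring_1 \<Rightarrow> 'a \<Rightarrow> 'a)"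
  by unfold_locales (simp_all add: algebra_simps)

definition ideal_generated :: "'a::comm_ring_1 set \<Rightarrow> 'a set" where
  "ideal_generated S = Modules.module.span (*) S"

definition SL :: "nat \<Rightarrow> 'a::comm_ring_1 mat set" where
  "SL n = {A \<in> carrier_mat n n. det A = 1}"

definition Pi2_ring :: "'a::comm_ring_1 itself \<Rightarrow> bool" where
  "Pi2_ring (_ :: 'a itself) \<longleftrightarrow>
     (\<forall>A :: 'a mat. A \<in> carrier_mat 2 2 \<and> ideal_generated (elements_mat A) = UNIV \<and> det A = 0 \<longrightarrow>
        (\<exists>B \<in> SL 3. \<forall>i<2. \<forall>j<2. B $$ (i, j) = A $$ (i, j)))"

definition equivalent_mat :: "'a::comm_ring_1 mat \<Rightarrow> 'a mat \<Rightarrow> bool" where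
  "equivalent_mat A D \<longleftrightarrow>
     (\<exists>P Q. P \<in> carrier_mat (dim_row A) (dim_row A) \<and> invertible_mat P \<and>
            Q \<in> carrier_mat (dim_col A) (dim_col A) \<and> invertible_mat Q \<and>
            D = P * A * Q)"

text \<open>
  The predicate \<^const>\<open>diagonal_mat\<close> also applies to rectangular matrices.
\<close>

definition elementary_divisor_ring :: "'a::comm_ring_1 itself \<Rightarrow> bool" where
  "elementary_divisor_ring (_ :: 'a itself) \<longleftrightarrow>
     (\<forall>m\<ge>1. \<forall>n\<ge>1. \<forall>A :: 'a mat. A \<in> carrier_mat m n \<longrightarrow>
        (\<exists>D. equivalent_mat A D \<and> diagonal_mat D \<and>
             (\<forall>i. i + 1 < min m n \<longrightarrow> D $$ (i, i) dvd D $$ (i + 1, i + 1))))"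

text \<open>
  The condition \<open>1 \<noteq> 0\<close> is part of the class \<^class>\<open>comm_ring_1\<close>.
\<close>

definition integral_domain :: "'a::comm_ring_1 itself \<Rightarrow> bool" where
  "integral_domain (_ :: 'a itself) \<longleftrightarrow> (\<forall>a b :: 'a. a * b = 0 \<longrightarrow> a = 0 \<or> b = 0)"

end

theory Submission
  imports Defs
begin

text \<open>
  The homogeneous equation with \<open>\<Delta> = 1\<close> shows that a \<open>J\<^sub>2\<^sub>,\<^sub>1\<close> ring is a Hermite ring.  Both the
  \<open>\<Pi>\<^sub>2\<close> condition and the elementary divisor property force every unimodular \<open>2 \<times> 2\<close> matrix of
  determinant 0 to factor as \<open>u v\<^sup>T\<close>, and this factorization in turn gives the \<open>\<Pi>\<^sub>2\<close> condition; a Hermite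
  domain always has it.  If \<open>A\<close> is a unimodular \<open>2 \<times> 2\<close> matrix, the \<open>J\<^sub>2\<^sub>,\<^sub>1\<close> condition for
  \<open>tr (A X) = 1\<close> and \<open>det X = 0\<close> yields such an \<open>X = u v\<^sup>T\<close>, so that \<open>v\<^sup>T A u = 1\<close>.  Over a Hermite ring
  this property passes from \<open>2 \<times> 2\<close> to arbitrary matrices; completing the two vectors to invertible
  matrices makes an entry equal to 1, and after clearing its row and column one recurses.
\<close>

subsection \<open>Hermite rings and rank one factorizations\<close>

text \<open>Kaplansky's Hermite condition in scalar form: \<open>(x, y)\<close> is the first row of
  the matrix \<open>(x, y; - t, s)\<close> of determinant 1, whose inverse carries the row
  \<open>(a, b)\<close> to \<open>(g, 0)\<close>.\<close>

definition hermite_ring :: "'a::comm_ring_1 itself \<Rightarrow> bool" where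
  "hermite_ring (_ :: 'a itself) \<longleftrightarrow>
     (\<forall>a b :: 'a. \<exists>g x y s t. a = g * x \<and> b = g * y \<and> s * x + t * y = 1)"

text \<open>Unimodularity of u and v need not be demanded: it follows from that of the product, by
  grouping the linear relation along rows or columns.\<close>

definition rank_one_ring :: "'a::comm_ring_1 itself \<Rightarrow> bool" where
  "rank_one_ring (_ :: 'a itself) \<longleftrightarrow>
     (\<forall>a b c d :: 'a. a * d = b * c \<and> (\<exists>x y z w. a * x + b * y + c * z + d * w = 1) \<longrightarrow>
        (\<exists>u1 u2 v1 v2. a = u1 * v1 \<and> b = u1 * v2 \<and> c = u2 * v1 \<and> d = u2 * v2))"

definition bilinear_unit_ring :: "'a::comm_ring_1 itself \<Rightarrow> bool" where
  "bilinear_unit_ring (_ :: 'a itself) \<longleftrightarrow>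
     (\<forall>a b c d :: 'a. (\<exists>x y z w. a * x + b * y + c * z + d * w = 1) \<longrightarrow>
        (\<exists>u1 u2 v1 v2. a * (u1 * v1) + b * (u1 * v2) + c * (u2 * v1) + d * (u2 * v2) = 1))"

lemma hermite_ringE:
  fixes a b :: "'a::comm_ring_1"
  assumes "hermite_ring TYPE('a)"
  obtains g x y s t where "a = g * x" "b = g * y" "s * x + t * y = 1"
  using assms unfolding hermite_ring_def by metis

lemma rank_one_ringE:
  fixes a b c d x y z w :: "'a::comm_ring_1"
  assumes "rank_one_ring TYPE('a)" "a * d = b * c" "a * x + b * y + c * z + d * w = 1"
  obtains u1 u2 v1 v2 where "a = u1 * v1" "b = u1 * v2" "c = u2 * v1" "d = u2 * v2"
  using assms unfolding rank_one_ring_def by metis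

lemma J21_ringE:
  fixes a b c d x y z w \<alpha> \<Delta> :: "'a::comm_ring_1"
  assumes "J21_ring TYPE('a)" "a * x + b * y + c * z + d * w = \<alpha>"
  obtains x' y' z' w'
  where "a * x' + b * y' + c * z' + d * w' = \<alpha>" "x' * y' - z' * w' = \<Delta>"
  using assms unfolding J21_ring_def by metis

text \<open>
  A solution of \<open>a x + b z = 0\<close> with \<open>x y - z w = 1\<close> gives a matrix of determinant 1 that maps
  the row \<open>(a, b)\<close> to \<open>(0, a w + b y)\<close>.
\<close>

lemma J21_imp_hermite:
  assumes "J21_ring TYPE('a::comm_ring_1)"
  shows "hermite_ring TYPE('a)"
  unfolding hermite_ring_def
proof (intro allI)
  fix a b :: 'a
  have "a * 0 + 0 * 0 + b * 0 + 0 * 0 = 0" by simp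
  then obtain x y z w where 1: "a * x + 0 * y + b * z + 0 * w = 0" and 2: "x * y - z * w = 1"
    by (rule J21_ringE[OF assms])
  let ?g = "a * w + b * y"
  have "a = ?g * (- z)"
  proof -
    have "?g * (- z) = a * (x * y - z * w) - y * (a * x + b * z)" by (simp add: algebra_simps)
    then show ?thesis using 1 2 by simp
  qed
  moreover have "b = ?g * x"
  proof -
    have "?g * x = b * (x * y - z * w) + w * (a * x + b * z)" by (simp add: algebra_simps)
    then show ?thesis using 1 2 by simp
  qed
  moreover have "w * (- z) + y * x = 1" using 2 by (simp add: algebra_simps)
  ultimately show "\<exists>g x y s t. a = g * x \<and> b = g * y \<and> s * x + t * y = 1" by blast
qed

lemma J21_rank_one_imp_bilinear_unit:
  assumes "J21_ring TYPE('a::comm_ring_1)" "rank_one_ring TYPE('a)"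
  shows "bilinear_unit_ring TYPE('a)"
  unfolding bilinear_unit_ring_def
proof (intro allI impI)
  fix a b c d :: 'a
  assume "\<exists>x y z w. a * x + b * y + c * z + d * w = 1"
  then obtain x y z w where "a * x + b * y + c * z + d * w = 1" by blast
  \<comment> \<open>The \<open>J21_ring\<close> condition multiplies the first two indeterminates,
    so the diagonal coefficients \<open>a\<close> and \<open>d\<close> move there and
    \<open>\<Delta>\<close> becomes the determinant of \<open>(p, q; r, s)\<close>.\<close>
  then have "a * x + d * w + b * y + c * z = 1" by (simp add: algebra_simps)
  then obtain p q r s where 1: "a * p + d * s + b * q + c * r = 1" and 2: "p * s - q * r = 0"
    by (rule J21_ringE[OF assms(1)])
  \<comment> \<open>Read with the roles exchanged, the equation says that
    \<open>(p, q; r, s)\<close> is unimodular, with coefficients \<open>a\<close>, \<open>b\<close>,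
    \<open>c\<close>, \<open>d\<close>; being singular, it factors.\<close>
  have "p * s = q * r" "p * a + q * b + r * c + s * d = 1"
    using 1 2 by (simp_all add: algebra_simps)
  then obtain u1 u2 v1 v2
    where uv: "p = u1 * v1" "q = u1 * v2" "r = u2 * v1" "s = u2 * v2"
    by (rule rank_one_ringE[OF assms(2)])
  have "a * (u1 * v1) + b * (u1 * v2) + c * (u2 * v1) + d * (u2 * v2) = 1"
    using 1 unfolding uv by (simp add: algebra_simps)
  then show "\<exists>u1 u2 v1 v2. a * (u1 * v1) + b * (u1 * v2) + c * (u2 * v1) + d * (u2 * v2) = 1"
    by blast
qed

text \<open>With \<open>(a, b) = g (x, y)\<close> and \<open>(x, y)\<close> unimodular, cancelling
  \<open>g \<noteq> 0\<close> in the determinant makes \<open>(c, d)\<close> proportional to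
  \<open>(x, y)\<close>. For \<open>g = 0\<close> the first row vanishes and the second serves as
  v.\<close>

lemma integral_domain_hermite_imp_rank_one:
  assumes "integral_domain TYPE('a::comm_ring_1)" "hermite_ring TYPE('a)"
  shows "rank_one_ring TYPE('a)"
  unfolding rank_one_ring_def
proof (intro allI impI, elim conjE)
  fix a b c d :: 'a
  assume det: "a * d = b * c"
  obtain g x y s t where ab: "a = g * x" "b = g * y" and st: "s * x + t * y = 1"
    using hermite_ringE[OF assms(2)] .
  have "g * (x * d - y * c) = 0" using det ab by (simp add: algebra_simps)
  then consider "g = 0" | "x * d - y * c = 0"
    using assms(1) unfolding integral_domain_def by blast
  then show "\<exists>u1 u2 v1 v2. a = u1 * v1 \<and> b = u1 * v2 \<and> c = u2 * v1 \<and> d = u2 * v2"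
  proof cases
    case 1
    then show ?thesis using ab by (intro exI[of _ 0] exI[of _ 1] exI[of _ c] exI[of _ d]) simp
  next
    case 2
    then have xd: "x * d = y * c" by simp
    \<comment> \<open>Pairing \<open>(c, d) = k (x, y)\<close> with \<open>(s, t)\<close> recovers
      the factor k.\<close>
    let ?k = "s * c + t * d"
    have "?k * x = (s * x + t * y) * c + t * (x * d - y * c)"
      and "?k * y = (s * x + t * y) * d - s * (x * d - y * c)" by (simp_all add: algebra_simps)
    then have "c = ?k * x" "d = ?k * y" using st 2 by simp_all
    then show ?thesis using ab by blast
  qed
qed

section \<open>Finite families and bilinear forms of arbitrary size\<close>

text \<open>Iterating the two-element condition gives a generator \<open>g\<close> of the ideal of
  the family whose cofactors \<open>b\<close> are unimodular, even if \<open>g\<close> is a zero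
  divisor.\<close>

lemma hermite_family:
  fixes a :: "'i \<Rightarrow> 'a::comm_ring_1"
  assumes "hermite_ring TYPE('a)" "finite I" "I \<noteq> {}"
  shows "\<exists>g b s. (\<forall>i\<in>I. a i = g * b i) \<and> (\<Sum>i\<in>I. s i * b i) = 1"
  using assms(2,3)
proof (induction I rule: finite_ne_induct)
  case (singleton i)
  show ?case by (intro exI[of _ "a i"] exI[of _ "\<lambda>_. 1"]) simp
next
  case (insert i I)
  then obtain g b s where gb: "\<forall>i\<in>I. a i = g * b i" and sb: "(\<Sum>i\<in>I. s i * b i) = 1"
    by blast
  obtain h x y p q where h: "a i = h * x" "g = h * y" and pq: "p * x + q * y = 1"
    using hermite_ringE[OF assms(1)] .
  let ?b = "\<lambda>j. if j = i then x else y * b j"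
  let ?s = "\<lambda>j. if j = i then p else q * s j"
  have "(\<Sum>j\<in>I. ?s j * ?b j) = (\<Sum>j\<in>I. q * y * (s j * b j))"
    using insert.hyps by (intro sum.cong) (auto simp: algebra_simps)
  also have "\<dots> = q * y" using sb by (simp flip: sum_distrib_left)
  finally have "(\<Sum>j\<in>insert i I. ?s j * ?b j) = 1"
    using insert.hyps pq by simp
  moreover have "\<forall>j\<in>insert i I. a j = h * ?b j"
    using gb h by (auto simp: algebra_simps)
  ultimately show ?case by (intro exI[of _ h] exI[of _ ?b] exI[of _ ?s] conjI)
qed

text \<open>
  In the induction step \<open>p\<close> and \<open>q\<close> belong to the first \<open>m\<close> rows, divided by their content \<open>d\<close>.
  The functional \<open>f\<close> given by these rows and \<open>p\<close> splits off \<open>q\<close>, and \<open>q'\<close> lies in its kernel and is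
  mapped by the last row \<open>r\<close> to a generator \<open>g\<close> of the image of that kernel.  On the rows \<open>r\<close> and
  \<open>d f\<close> and the columns \<open>q\<close> and \<open>q'\<close> the problem is the \<open>2 \<times> 2\<close> one for \<open>(\<rho>, g; d, 0)\<close>.
\<close>

lemma bilinear_unit_sum:
  fixes A S :: "nat \<Rightarrow> nat \<Rightarrow> 'a::comm_ring_1"
  assumes H: "hermite_ring TYPE('a)" and B: "bilinear_unit_ring TYPE('a)"
    and "(\<Sum>i<m. \<Sum>j<n. S i j * A i j) = 1"
  shows "\<exists>p q. (\<Sum>i<m. \<Sum>j<n. p i * A i j * q j) = 1"
  using assms(3)
proof (induction m arbitrary: A S)
  case 0
  then show ?case by simp
next
  case (Suc m)
  show ?case
  \<comment> \<open>A single row is treated apart, since the content of the first \<open>m\<close>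
    rows is taken over a nonempty family.\<close>
  proof (cases "m = 0")
    case True
    then show ?thesis using Suc.prems
      by (intro exI[of _ "\<lambda>_. 1"] exI[of _ "S 0"]) (simp add: mult.commute)
  next
    case False
    have n: "n \<noteq> 0" using Suc.prems by (intro notI) simp
    have "finite ({..<m} \<times> {..<n})" "{..<m} \<times> {..<n} \<noteq> {}" using False n by auto
    from hermite_family[OF H this, of "\<lambda>(i, j). A i j"] obtain d A0 S0
      where dA0: "\<forall>ij\<in>{..<m} \<times> {..<n}. (case ij of (i, j) \<Rightarrow> A i j) = d * A0 ij"
        and S0: "(\<Sum>ij\<in>{..<m} \<times> {..<n}. S0 ij * A0 ij) = 1" by blast
    define A' where "A' = curry A0"
    have A': "A i j = d * A' i j" if "i < m" "j < n" for i j
      using dA0 that by (simp add: A'_def)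
    have "(\<Sum>i<m. \<Sum>j<n. curry S0 i j * A' i j) = 1"
      using S0 by (simp add: A'_def sum.cartesian_product case_prod_unfold)
    from Suc.IH[OF this] obtain p q where pq: "(\<Sum>i<m. \<Sum>j<n. p i * A' i j * q j) = 1"
      by blast
    define f where "f j = (\<Sum>i<m. p i * A' i j)" for j
    have fsum: "(\<Sum>i<m. \<Sum>j<n. p i * A' i j * y j) = (\<Sum>j<n. f j * y j)" for y
      by (subst sum.swap) (simp add: f_def sum_distrib_right)
    have fq: "(\<Sum>j<n. f j * q j) = 1" using pq fsum by simp
    define r where "r = A m"
    define \<rho> where "\<rho> = (\<Sum>j<n. r j * q j)"
    have "{..<n} \<noteq> {}" using n by auto
    \<comment> \<open>The functional \<open>r - \<rho> f\<close> vanishes at \<open>q\<close> and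
      agrees with \<open>r\<close> on the kernel of \<open>f\<close>; hence its content
      \<open>g\<close> generates the image of that kernel under \<open>r\<close>.\<close>
    from hermite_family[OF H finite_lessThan this, of "\<lambda>j. r j - f j * \<rho>"] obtain g t s
      where "\<forall>j\<in>{..<n}. r j - f j * \<rho> = g * t j"
        and st: "(\<Sum>j<n. s j * t j) = 1" by blast
    then have rj: "r j = f j * \<rho> + g * t j" if "j < n" for j
      using that by (simp add: diff_eq_eq add.commute)
    \<comment> \<open>\<open>q'\<close> is the projection of \<open>s\<close> to the kernel of
      \<open>f\<close> along \<open>q\<close>.\<close>
    define \<phi> where "\<phi> = (\<Sum>j<n. f j * s j)"
    define q' where "q' j = s j - \<phi> * q j" for j
    have fq': "(\<Sum>j<n. f j * q' j) = 0"
    proof -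
      have "(\<Sum>j<n. f j * q' j) = (\<Sum>j<n. f j * s j) - \<phi> * (\<Sum>j<n. f j * q j)"
        by (simp add: q'_def sum_distrib_left sum_subtractf algebra_simps)
      then show ?thesis using fq by (simp add: \<phi>_def)
    qed
    have rq': "(\<Sum>j<n. r j * q' j) = g"
    proof -
      have "(\<Sum>j<n. r j * q' j) = (\<Sum>j<n. r j * s j) - \<phi> * \<rho>"
        by (simp add: q'_def \<rho>_def sum_distrib_left sum_subtractf algebra_simps)
      also have "\<dots> = (\<Sum>j<n. s j * (r j - f j * \<rho>))"
        by (simp add: \<phi>_def sum_distrib_left sum_distrib_right sum_subtractf algebra_simps)
      also have "\<dots> = (\<Sum>j<n. g * (s j * t j))"
        by (intro sum.cong) (simp_all add: rj algebra_simps)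
      also have "\<dots> = g" using st by (simp flip: sum_distrib_left)
      finally show ?thesis .
    qed
    \<comment> \<open>The first \<open>m\<close> rows are multiples of \<open>d\<close>, and the
      last is \<open>\<rho> f + g t\<close>. The given relation therefore expresses 1 through
      \<open>\<rho>\<close>, \<open>g\<close> and \<open>d\<close>, which is unimodularity of the
      small matrix.\<close>
    have "1 = (\<Sum>i<m. \<Sum>j<n. S i j * A i j) + (\<Sum>j<n. S m j * r j)"
      using Suc.prems by (simp add: r_def)
    also have "(\<Sum>i<m. \<Sum>j<n. S i j * A i j) = d * (\<Sum>i<m. \<Sum>j<n. S i j * A' i j)"
      unfolding sum_distrib_left by (intro sum.cong) (simp_all add: A' algebra_simps)
    also have "(\<Sum>j<n. S m j * r j) = (\<Sum>j<n. \<rho> * (S m j * f j) + g * (S m j * t j))"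
      by (intro sum.cong) (simp_all add: rj algebra_simps)
    also have "\<dots> = \<rho> * (\<Sum>j<n. S m j * f j) + g * (\<Sum>j<n. S m j * t j)"
      by (simp add: sum_distrib_left sum.distrib)
    finally have "\<rho> * (\<Sum>j<n. S m j * f j) + g * (\<Sum>j<n. S m j * t j)
        + d * (\<Sum>i<m. \<Sum>j<n. S i j * A' i j) + 0 * 0 = 1"
      by (simp add: algebra_simps)
    then obtain u1 u2 v1 v2
      where uv: "\<rho> * (u1 * v1) + g * (u1 * v2) + d * (u2 * v1) + 0 * (u2 * v2) = 1"
      using B unfolding bilinear_unit_ring_def by blast
    \<comment> \<open>The weights \<open>u2 * p\<close> combine the first \<open>m\<close> rows into
      \<open>u2 d f\<close>; the last row, first in the small matrix, gets
      \<open>u1\<close>.\<close>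
    define P where "P i = (if i < m then u2 * p i else u1)" for i
    define Q where "Q j = v1 * q j + v2 * q' j" for j
    have "(\<Sum>i<m. \<Sum>j<n. P i * A i j * Q j) = u2 * d * (\<Sum>i<m. \<Sum>j<n. p i * A' i j * Q j)"
      unfolding sum_distrib_left by (intro sum.cong) (simp_all add: A' P_def algebra_simps)
    also have "(\<Sum>i<m. \<Sum>j<n. p i * A' i j * Q j) = (\<Sum>j<n. f j * Q j)" by (rule fsum)
    also have "\<dots> = v1 * (\<Sum>j<n. f j * q j) + v2 * (\<Sum>j<n. f j * q' j)"
      by (simp add: Q_def sum_distrib_left sum.distrib algebra_simps)
    finally have 1: "(\<Sum>i<m. \<Sum>j<n. P i * A i j * Q j) = u2 * d * v1" using fq fq' by simp
    have "(\<Sum>j<n. P m * A m j * Q j) = u1 * v1 * \<rho> + u1 * v2 * (\<Sum>j<n. r j * q' j)"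
      by (simp add: P_def Q_def r_def \<rho>_def sum_distrib_left sum.distrib algebra_simps)
    with 1 rq' uv have "(\<Sum>i<Suc m. \<Sum>j<n. P i * A i j * Q j) = 1"
      by (simp add: algebra_simps)
    then show ?thesis by blast
  qed
qed

subsection \<open>Equivalence of matrices\<close>

definition GL :: "nat \<Rightarrow> 'a::comm_ring_1 mat set" where
  "GL n = {P \<in> carrier_mat n n. invertible_mat P}"

lemma GL_carrier: "P \<in> GL n \<Longrightarrow> P \<in> carrier_mat n n"
  by (simp add: GL_def)

lemma GL_I:
  assumes "P \<in> carrier_mat n n" "P' \<in> carrier_mat n n" "P * P' = 1\<^sub>m n" "P' * P = 1\<^sub>m n"
  shows "P \<in> GL n"
  using assms unfolding GL_def invertible_mat_def inverts_mat_def by auto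

lemma GL_E:
  assumes "P \<in> GL n"
  obtains P' where "P' \<in> carrier_mat n n" "P * P' = 1\<^sub>m n" "P' * P = 1\<^sub>m n"
proof -
  from assms have P: "P \<in> carrier_mat n n" by (rule GL_carrier)
  from assms obtain P' where 1: "P * P' = 1\<^sub>m n" and 2: "P' * P = 1\<^sub>m (dim_row P')"
    unfolding GL_def invertible_mat_def inverts_mat_def by auto
  \<comment> \<open>The definition of invertibility does not state the size of \<open>P'\<close>; it
    is read off from the two identity matrices.\<close>
  have "dim_col P' = n" using arg_cong[OF 1, of dim_col] by simp
  moreover have "dim_row P' = n" using arg_cong[OF 2, of dim_col] P by simp
  ultimately show thesis using that 1 2 by auto
qed

lemma one_in_GL: "1\<^sub>m n \<in> GL n"
  by (rule GL_I[of _ _ "1\<^sub>m n"]) simp_all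

lemma GL_mult:
  assumes "P \<in> GL n" "Q \<in> GL n"
  shows "P * Q \<in> GL n"
proof -
  note [simp] = assms[THEN GL_carrier] mult_carrier_mat[of _ n n _ n]
  obtain P' where [simp]: "P' \<in> carrier_mat n n" and P: "P * P' = 1\<^sub>m n" "P' * P = 1\<^sub>m n"
    using assms(1) by (rule GL_E)
  obtain Q' where [simp]: "Q' \<in> carrier_mat n n" and Q: "Q * Q' = 1\<^sub>m n" "Q' * Q = 1\<^sub>m n"
    using assms(2) by (rule GL_E)
  have "P * Q * (Q' * P') = P * ((Q * Q') * P')"
    by (simp add: assoc_mult_mat[of _ n n _ n _ n])
  moreover have "Q' * P' * (P * Q) = Q' * ((P' * P) * Q)"
    by (simp add: assoc_mult_mat[of _ n n _ n _ n])
  ultimately show ?thesis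
    by (intro GL_I[of _ _ "Q' * P'"]) (simp_all add: P Q left_mult_one_mat[of _ n n])
qed

lemma GL_transpose:
  assumes "P \<in> GL n"
  shows "P\<^sup>T \<in> GL n"
proof -
  note P = GL_carrier[OF assms]
  obtain P' where P': "P' \<in> carrier_mat n n" and "P * P' = 1\<^sub>m n" "P' * P = 1\<^sub>m n"
    using assms by (rule GL_E)
  then have "P\<^sup>T * P'\<^sup>T = 1\<^sub>m n" "P'\<^sup>T * P\<^sup>T = 1\<^sub>m n"
    by (metis transpose_mult[OF P P'] transpose_mult[OF P' P] transpose_one)+
  then show ?thesis using P P' by (intro GL_I[of _ _ "P'\<^sup>T"]) simp_all
qed

lemma GL_block_diag:
  assumes "P \<in> GL m" "Q \<in> GL n"
  shows "four_block_mat P (0\<^sub>m m n) (0\<^sub>m n m) Q \<in> GL (m + n)"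
proof -
  note [simp] = assms[THEN GL_carrier]
  obtain P' where [simp]: "P' \<in> carrier_mat m m" and P: "P * P' = 1\<^sub>m m" "P' * P = 1\<^sub>m m"
    using assms(1) by (rule GL_E)
  obtain Q' where [simp]: "Q' \<in> carrier_mat n n" and Q: "Q * Q' = 1\<^sub>m n" "Q' * Q = 1\<^sub>m n"
    using assms(2) by (rule GL_E)
  let ?R = "four_block_mat P' (0\<^sub>m m n) (0\<^sub>m n m) Q'"
  show ?thesis
    by (intro GL_I[of _ _ ?R])
      (simp_all add: P Q mult_four_block_mat[of _ m m _ n _ n _ _ m _ n]
        right_mult_zero_mat[of _ m m] right_mult_zero_mat[of _ n n]
        left_mult_zero_mat[of _ m m] left_mult_zero_mat[of _ n n])
qed

lemma GL_block_lower:
  fixes C :: "'a::comm_ring_1 mat"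
  assumes "C \<in> carrier_mat n m"
  shows "four_block_mat (1\<^sub>m m) (0\<^sub>m m n) C (1\<^sub>m n) \<in> GL (m + n)"
proof -
  note [simp] = assms carrier_matD[OF assms]
  have [simp]: "C + - C = 0\<^sub>m n m" "- C + C = 0\<^sub>m n m" by auto
  have [simp]: "1\<^sub>m m + - 0\<^sub>m m m = (1\<^sub>m m :: 'a mat)" by (intro eq_matI) simp_all
  let ?R = "four_block_mat (1\<^sub>m m) (0\<^sub>m m n) (- C) (1\<^sub>m n)"
  show ?thesis
    by (intro GL_I[of _ _ ?R]) (simp_all add: mult_four_block_mat[of _ m m _ n _ n _ _ m _ n])
qed

lemma GL_block_upper:
  assumes "C \<in> carrier_mat m n"
  shows "four_block_mat (1\<^sub>m m) C (0\<^sub>m n m) (1\<^sub>m n) \<in> GL (m + n)"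
  using GL_transpose[OF GL_block_lower[of "C\<^sup>T" n m]] assms
  by (simp add: transpose_four_block_mat[of _ m m _ n _ n] transpose_one transpose_mat_def[of "0\<^sub>m _ _"])

section \<open>Equivalent matrices and block reduction\<close>

lemma equivalent_matI:
  assumes "A \<in> carrier_mat m n" "P \<in> GL m" "Q \<in> GL n"
  shows "equivalent_mat A (P * A * Q)"
  using assms unfolding equivalent_mat_def GL_def by auto

lemma equivalent_matE:
  assumes "equivalent_mat A D" "A \<in> carrier_mat m n"
  obtains P Q where "P \<in> GL m" "Q \<in> GL n" "D = P * A * Q"
  using assms unfolding equivalent_mat_def GL_def by auto

lemma equivalent_mat_refl: "equivalent_mat A A"
  using equivalent_matI[of A "dim_row A" "dim_col A", OF _ one_in_GL one_in_GL] by auto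

lemma equivalent_mat_carrier:
  assumes "equivalent_mat A D" "A \<in> carrier_mat m n"
  shows "D \<in> carrier_mat m n"
  using equivalent_matE[OF assms] GL_carrier by (metis assms(2) mult_carrier_mat)

lemma equivalent_mat_trans [trans]:
  assumes "equivalent_mat A B" "equivalent_mat B D"
  shows "equivalent_mat A D"
proof -
  define m n where "m = dim_row A" and "n = dim_col A"
  have A [simp]: "A \<in> carrier_mat m n" by (simp add: m_def n_def)
  have B: "B \<in> carrier_mat m n" using equivalent_mat_carrier[OF assms(1) A] .
  obtain P Q where PQ: "P \<in> GL m" "Q \<in> GL n" "B = P * A * Q"
    using assms(1) A by (rule equivalent_matE)
  obtain P' Q' where PQ': "P' \<in> GL m" "Q' \<in> GL n" "D = P' * B * Q'"
    using assms(2) B by (rule equivalent_matE)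
  note [simp] = PQ(1,2)[THEN GL_carrier] PQ'(1,2)[THEN GL_carrier]
  note [simp] = mult_carrier_mat[of _ m m _ m] mult_carrier_mat[of _ m m _ n]
    mult_carrier_mat[of _ m n _ n] mult_carrier_mat[of _ n n _ n]
  have "D = (P' * P) * A * (Q * Q')"
    by (simp add: PQ(3) PQ'(3) assoc_mult_mat[of _ m n _ n _ n] assoc_mult_mat[of _ m m _ m _ n]
        assoc_mult_mat[of _ m m _ n _ n])
  then show ?thesis
    using equivalent_matI[OF A GL_mult[OF PQ'(1) PQ(1)] GL_mult[OF PQ(2) PQ'(2)]] by simp
qed

text \<open>Lets a common factor of the entries be set aside during the reduction and restored at
  the end.\<close>

lemma equivalent_mat_smult:
  assumes "equivalent_mat A D"
  shows "equivalent_mat (g \<cdot>\<^sub>m A) (g \<cdot>\<^sub>m D)"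
proof -
  define m n where "m = dim_row A" and "n = dim_col A"
  have A: "A \<in> carrier_mat m n" by (simp add: m_def n_def)
  obtain P Q where PQ: "P \<in> GL m" "Q \<in> GL n" "D = P * A * Q"
    using assms A by (rule equivalent_matE)
  note c = PQ(1,2)[THEN GL_carrier]
  have "g \<cdot>\<^sub>m D = P * (g \<cdot>\<^sub>m A) * Q"
    using A c by (simp add: PQ(3) mult_smult_distrib[of _ m m _ n] mult_smult_assoc_mat[of _ m n _ n])
  then show ?thesis using equivalent_matI[OF smult_carrier_mat[OF A] PQ(1,2)] by simp
qed

lemma equivalent_mat_one_block:
  assumes "equivalent_mat A D" "A \<in> carrier_mat m n"
  shows "equivalent_mat (four_block_mat (1\<^sub>m k) (0\<^sub>m k n) (0\<^sub>m m k) A)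
    (four_block_mat (1\<^sub>m k) (0\<^sub>m k n) (0\<^sub>m m k) D)"
proof -
  note A [simp] = assms(2)
  obtain P Q where PQ: "P \<in> GL m" "Q \<in> GL n" "D = P * A * Q"
    using assms by (rule equivalent_matE)
  note [simp] = PQ(1,2)[THEN GL_carrier]
  have [simp]: "P * A \<in> carrier_mat m n" "P * A * Q \<in> carrier_mat m n"
    by (metis GL_carrier PQ(1,2) A mult_carrier_mat)+
  have "four_block_mat (1\<^sub>m k) (0\<^sub>m k n) (0\<^sub>m m k) D
    = four_block_mat (1\<^sub>m k) (0\<^sub>m k m) (0\<^sub>m m k) P
      * four_block_mat (1\<^sub>m k) (0\<^sub>m k n) (0\<^sub>m m k) A
      * four_block_mat (1\<^sub>m k) (0\<^sub>m k n) (0\<^sub>m n k) Q"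
    by (simp add: PQ(3) mult_four_block_mat[of _ k k _ m _ m _ _ k _ n]
        mult_four_block_mat[of _ k k _ n _ m _ _ k _ n]
        right_mult_zero_mat[of _ m m] right_mult_zero_mat[of _ m n]
        left_mult_zero_mat[of _ m n] left_mult_zero_mat[of _ n n])
  then show ?thesis
    using equivalent_matI[OF four_block_carrier_mat[OF one_carrier_mat A]
        GL_block_diag[OF one_in_GL PQ(1)] GL_block_diag[OF one_in_GL PQ(2)]] by simp
qed

text \<open>Block elimination with an identity pivot; \<open>E - C * R\<close> is its Schur
  complement.\<close>

lemma equivalent_mat_clear_one:
  assumes "R \<in> carrier_mat k n" "C \<in> carrier_mat m k" "E \<in> carrier_mat m n"
  shows "equivalent_mat (four_block_mat (1\<^sub>m k) R C E)
    (four_block_mat (1\<^sub>m k) (0\<^sub>m k n) (0\<^sub>m m k) (E - C * R))"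
proof -
  note [simp] = assms mult_carrier_mat[OF assms(2,1)] carrier_matD[OF assms(1)]
    carrier_matD[OF assms(2)] carrier_matD[OF assms(3)]
  have [simp]: "- C + C = 0\<^sub>m m k" "- R + R = 0\<^sub>m k n" using assms by auto
  have [simp]: "E - C * R \<in> carrier_mat m n" by (rule minus_carrier_mat) simp
  have [simp]: "- 0\<^sub>m m n + (E - C * R) = E - C * R" by (intro eq_matI) simp_all
  have "- C * R + E = E - C * R" by (intro eq_matI) simp_all
  then have "four_block_mat (1\<^sub>m k) (0\<^sub>m k n) (0\<^sub>m m k) (E - C * R)
    = four_block_mat (1\<^sub>m k) (0\<^sub>m k m) (- C) (1\<^sub>m m) * four_block_mat (1\<^sub>m k) R C E
      * four_block_mat (1\<^sub>m k) (- R) (0\<^sub>m n k) (1\<^sub>m n)"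
    by (simp add: mult_four_block_mat[of _ k k _ m _ m _ _ k _ n]
        mult_four_block_mat[of _ k k _ n _ m _ _ k _ n])
  then show ?thesis
    using equivalent_matI[OF four_block_carrier_mat[OF one_carrier_mat assms(3)]
        GL_block_lower[of "- C" m k] GL_block_upper[of "- R" k n]] by simp
qed

text \<open>The tail of \<open>v\<close> is completed recursively, and a determinant 1 matrix on two
  coordinates then merges its factor with \<open>v 0\<close>. For unimodular \<open>v\<close> the
  factor \<open>g\<close> is a unit, so \<open>v\<close> is a first column up to a unit.\<close>

lemma hermite_completion:
  fixes v :: "nat \<Rightarrow> 'a::comm_ring_1"
  assumes H: "hermite_ring TYPE('a)"
  shows "\<exists>g. \<exists>P\<in>GL (Suc n). \<forall>i<Suc n. v i = g * P $$ (i, 0)"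
proof (induction n arbitrary: v)
  case 0
  show ?case by (intro exI[of _ "v 0"] bexI[of _ "1\<^sub>m 1"]) (auto intro: one_in_GL)
next
  case (Suc n)
  obtain g P where P: "P \<in> GL (Suc n)" and v: "\<And>i. i < Suc n \<Longrightarrow> v (Suc i) = g * P $$ (i, 0)"
    using Suc[of "\<lambda>i. v (Suc i)"] by blast
  obtain h x y s t where h: "v 0 = h * x" "g = h * y" and st: "s * x + t * y = 1"
    using hermite_ringE[OF H] .
  \<comment> \<open>\<open>N\<close> has first column \<open>(x, y)\<close> and determinant
    \<open>s * x + t * y = 1\<close>; \<open>N'\<close> is its adjugate.\<close>
  define N where "N = mat 2 2 (\<lambda>(i, j). if i = 0 then if j = 0 then x else - t
    else if j = 0 then y else s)"
  define N' where "N' = mat 2 2 (\<lambda>(i, j). if i = 0 then if j = 0 then s else t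
    else if j = 0 then - y else x)"
  have N: "N \<in> GL 2"
  proof (rule GL_I[of _ _ N'])
    show "N * N' = 1\<^sub>m 2" "N' * N = 1\<^sub>m 2" using st
      by (intro eq_matI; auto simp: N_def N'_def scalar_prod_def less_2_cases_iff numeral_2_eq_2
          algebra_simps)+
  qed (simp_all add: N_def N'_def)
  define M where "M = four_block_mat (1\<^sub>m 1) (0\<^sub>m 1 (Suc n)) (0\<^sub>m (Suc n) 1) P"
  define L where "L = four_block_mat N (0\<^sub>m 2 n) (0\<^sub>m n 2) (1\<^sub>m n)"
  have M: "M \<in> GL (Suc (Suc n))" and L: "L \<in> GL (Suc (Suc n))"
    using GL_block_diag[OF one_in_GL[of 1] P] GL_block_diag[OF N one_in_GL[of n]]
    by (simp_all add: M_def L_def)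
  note carr = GL_carrier[OF M] GL_carrier[OF L] GL_carrier[OF P]
  \<comment> \<open>The first column of \<open>L\<close> is \<open>(x, y, 0, ..., 0)\<close>, so
    only the first two columns of \<open>M\<close> contribute.\<close>
  have "(M * L) $$ (i, 0) = M $$ (i, 0) * x + M $$ (i, 1) * y" if "i < Suc (Suc n)" for i
  proof -
    have "(M * L) $$ (i, 0) = (\<Sum>k = 0..<Suc (Suc n). M $$ (i, k) * L $$ (k, 0))"
      using carr that by (auto simp: scalar_prod_def)
    also have "\<dots> = (\<Sum>k = 0..<Suc (Suc n). M $$ (i, k) * (if k = 0 then x else if k = 1 then y else 0))"
      by (intro sum.cong) (auto simp: L_def N_def)
    finally show ?thesis
      by (simp add: sum.atLeast0_lessThan_Suc_shift del: sum.op_ivl_Suc)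
  qed
  moreover have "v i = h * (M $$ (i, 0) * x + M $$ (i, 1) * y)" if "i < Suc (Suc n)" for i
    using that h v[of "i - 1"] carr(3) by (cases i) (simp_all add: M_def algebra_simps)
  ultimately show ?case using GL_mult[OF M L] by metis
qed

subsection \<open>Diagonal reduction\<close>

lemma hermite_bilinear_unit_diagonal_form:
  fixes A :: "'a::comm_ring_1 mat"
  assumes H: "hermite_ring TYPE('a)" and B: "bilinear_unit_ring TYPE('a)"
    and "A \<in> carrier_mat m n"
  shows "\<exists>D. equivalent_mat A D \<and> diagonal_mat D \<and>
    (\<forall>i. i + 1 < min m n \<longrightarrow> D $$ (i, i) dvd D $$ (i + 1, i + 1))"
  using assms(3)
proof (induction m arbitrary: n A)
  case 0
  then show ?case by (intro exI[of _ A]) (auto simp: equivalent_mat_refl diagonal_mat_def)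
next
  case (Suc m)
  show ?case
  proof (cases n)
    case 0
    then show ?thesis using Suc.prems
      by (intro exI[of _ A]) (auto simp: equivalent_mat_refl diagonal_mat_def)
  next
    case (Suc k)
    have A: "A \<in> carrier_mat (Suc m) (Suc k)" using Suc.prems Suc by simp
    let ?I = "{..<Suc m} \<times> {..<Suc k}"
    have "finite ?I" "?I \<noteq> {}" by auto
    from hermite_family[OF H this, of "\<lambda>ij. A $$ ij"] obtain g a s
      where ga: "\<forall>ij\<in>?I. A $$ ij = g * a ij" and sa: "(\<Sum>ij\<in>?I. s ij * a ij) = 1"
      by (elim exE conjE)
    have "(\<Sum>i<Suc m. \<Sum>j<Suc k. curry s i j * curry a i j) = 1"
      using sa by (simp add: sum.cartesian_product case_prod_unfold del: sum.lessThan_Suc)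
    from bilinear_unit_sum[OF H B this] obtain p q
      where pq: "(\<Sum>i<Suc m. \<Sum>j<Suc k. p i * curry a i j * q j) = 1" by blast
    obtain gp P where P: "P \<in> GL (Suc m)" and p: "\<And>i. i < Suc m \<Longrightarrow> p i = gp * P $$ (i, 0)"
      using hermite_completion[OF H] by metis
    obtain gq Q where Q: "Q \<in> GL (Suc k)" and q: "\<And>j. j < Suc k \<Longrightarrow> q j = gq * Q $$ (j, 0)"
      using hermite_completion[OF H] by metis
    \<comment> \<open>\<open>e\<close> is the value of the bilinear form on the first columns of
      \<open>P\<close> and \<open>Q\<close>, a unit with inverse \<open>gp * gq\<close>.\<close>
    define e where "e = (\<Sum>i<Suc m. \<Sum>j<Suc k. P $$ (i, 0) * a (i, j) * Q $$ (j, 0))"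
    have e: "gp * gq * e = 1"
    proof -
      have "(\<Sum>i<Suc m. \<Sum>j<Suc k. p i * curry a i j * q j) = gp * gq * e"
        unfolding e_def sum_distrib_left by (intro sum.cong) (simp_all add: p q algebra_simps)
      with pq show ?thesis by simp
    qed
    \<comment> \<open>Scaling by \<open>gp * gq\<close> turns the corner entry \<open>e\<close> of
      the transformed matrix into exactly 1; the factor \<open>g * e\<close> in front
      compensates.\<close>
    define A' where "A' = mat (Suc m) (Suc k) (\<lambda>ij. gp * gq * a ij)"
    have A': "A' \<in> carrier_mat (Suc m) (Suc k)" by (simp add: A'_def)
    have AA': "A = (g * e) \<cdot>\<^sub>m A'"
    proof (rule eq_matI)
      fix i j assume "i < dim_row ((g * e) \<cdot>\<^sub>m A')" "j < dim_col ((g * e) \<cdot>\<^sub>m A')"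
      then have ij: "i < Suc m" "j < Suc k" by (simp_all add: A'_def)
      have "g * e * (gp * gq * a (i, j)) = gp * gq * e * (g * a (i, j))" by (simp add: algebra_simps)
      then show "A $$ (i, j) = ((g * e) \<cdot>\<^sub>m A') $$ (i, j)"
        using ij ga e by (simp add: A'_def)
    qed (use A in \<open>simp_all add: A'_def\<close>)
    define M where "M = P\<^sup>T * A' * Q"
    have M: "M \<in> carrier_mat (Suc m) (Suc k)"
      unfolding M_def
      by (rule mult_carrier_mat[OF mult_carrier_mat[OF GL_carrier[OF GL_transpose[OF P]] A']
            GL_carrier[OF Q]])
    have "M $$ (0, 0) = (\<Sum>j<Suc k. (\<Sum>i<Suc m. P $$ (i, 0) * A' $$ (i, j)) * Q $$ (j, 0))"
      using carrier_matD[OF GL_carrier[OF P]] carrier_matD[OF GL_carrier[OF Q]] carrier_matD[OF A']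
      by (simp add: M_def scalar_prod_def lessThan_atLeast0 del: sum.op_ivl_Suc)
    also have "\<dots> = (\<Sum>i<Suc m. \<Sum>j<Suc k. gp * gq * (P $$ (i, 0) * a (i, j) * Q $$ (j, 0)))"
      unfolding sum_distrib_right
      by (subst sum.swap, intro sum.cong) (simp_all add: A'_def algebra_simps)
    also have "\<dots> = 1" using e by (simp add: e_def flip: sum_distrib_left del: sum.lessThan_Suc)
    finally have M00: "M $$ (0, 0) = 1" .
    obtain U R C E where split: "split_block M 1 1 = (U, R, C, E)" by (metis prod_cases4)
    note blocks = split_block[OF split, of m k]
    have dims: "dim_row M = 1 + m" "dim_col M = 1 + k" using M by simp_all
    note R = blocks(2)[OF dims] and C = blocks(3)[OF dims] and E = blocks(4)[OF dims]
    have "U = 1\<^sub>m 1"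
      using M00 split by (intro eq_matI) (auto simp: split_block_def Let_def)
    then have "M = four_block_mat (1\<^sub>m 1) R C E" using blocks(5)[OF dims] by simp
    moreover define F where "F = E - C * R"
    ultimately have MF: "equivalent_mat M (four_block_mat (1\<^sub>m 1) (0\<^sub>m 1 k) (0\<^sub>m m 1) F)"
      using equivalent_mat_clear_one[OF R C E] by simp
    have F: "F \<in> carrier_mat m k"
      unfolding F_def by (rule minus_carrier_mat[OF mult_carrier_mat[OF C R]])
    from Suc.IH[OF F] obtain D where D: "equivalent_mat F D" "diagonal_mat D"
      and dvd: "\<And>i. i + 1 < min m k \<Longrightarrow> D $$ (i, i) dvd D $$ (i + 1, i + 1)" by blast
    note Dc = equivalent_mat_carrier[OF D(1) F]
    let ?D = "four_block_mat (1\<^sub>m 1) (0\<^sub>m 1 k) (0\<^sub>m m 1) D"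
    have "equivalent_mat A' M"
      unfolding M_def by (rule equivalent_matI[OF A' GL_transpose[OF P] Q])
    also note MF
    also note equivalent_mat_one_block[OF D(1) F]
    finally have "equivalent_mat A ((g * e) \<cdot>\<^sub>m ?D)"
      unfolding AA' by (rule equivalent_mat_smult)
    moreover have "diagonal_mat ((g * e) \<cdot>\<^sub>m ?D)"
      using D(2) Dc by (auto simp: diagonal_mat_def)
    \<comment> \<open>The first diagonal entry is \<open>g * e\<close> and divides all the others.
      Below it the indices are those of \<open>D\<close> shifted by one.\<close>
    moreover have "((g * e) \<cdot>\<^sub>m ?D) $$ (i, i) dvd ((g * e) \<cdot>\<^sub>m ?D) $$ (i + 1, i + 1)"
      if "i + 1 < min (Suc m) n" for i
      using that Suc Dc dvd[of "i - 1"] by (cases i) (auto intro: mult_dvd_mono)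
    ultimately show ?thesis by blast
  qed
qed

lemma hermite_bilinear_unit_imp_elementary_divisor:
  assumes "hermite_ring TYPE('a::comm_ring_1)" "bilinear_unit_ring TYPE('a)"
  shows "elementary_divisor_ring TYPE('a)"
  unfolding elementary_divisor_ring_def
  using hermite_bilinear_unit_diagonal_form[OF assms] by blast

subsection \<open>Singular matrices of size two\<close>

lemma det_2_by_2:
  assumes "A \<in> carrier_mat 2 2"
  shows "det A = A $$ (0, 0) * A $$ (1, 1) - A $$ (0, 1) * A $$ (1, 0)"
proof -
  have minor: "det (mat_delete A i j) = mat_delete A i j $$ (0, 0)" for i j
    by (rule det_single) (use mat_delete_carrier[OF assms, of i j] in simp)
  have "det (mat_delete A 0 0) = A $$ (1, 1)" "det (mat_delete A 0 1) = A $$ (1, 0)"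
    unfolding minor using assms by (simp_all add: mat_delete_def)
  then show ?thesis
    using laplace_expansion_row[OF assms, of 0] by (simp add: cofactor_def numeral_2_eq_2)
qed

lemma det_3_by_3:
  assumes "A \<in> carrier_mat 3 3"
  shows "det A = A $$ (0, 0) * (A $$ (1, 1) * A $$ (2, 2) - A $$ (1, 2) * A $$ (2, 1))
    - A $$ (0, 1) * (A $$ (1, 0) * A $$ (2, 2) - A $$ (1, 2) * A $$ (2, 0))
    + A $$ (0, 2) * (A $$ (1, 0) * A $$ (2, 1) - A $$ (1, 1) * A $$ (2, 0))"
proof -
  have "mat_delete A i j \<in> carrier_mat 2 2" for i j
    using mat_delete_carrier[OF assms, of i j] by simp
  note minor = det_2_by_2[OF this]
  have "det (mat_delete A 0 0) = A $$ (1, 1) * A $$ (2, 2) - A $$ (1, 2) * A $$ (2, 1)"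
    "det (mat_delete A 0 1) = A $$ (1, 0) * A $$ (2, 2) - A $$ (1, 2) * A $$ (2, 0)"
    "det (mat_delete A 0 2) = A $$ (1, 0) * A $$ (2, 1) - A $$ (1, 1) * A $$ (2, 0)"
    unfolding minor using assms by (simp_all add: mat_delete_def numeral_2_eq_2)
  moreover have "det A = A $$ (0, 0) * det (mat_delete A 0 0)
      - A $$ (0, 1) * det (mat_delete A 0 1) + A $$ (0, 2) * det (mat_delete A 0 2)"
    using laplace_expansion_row[OF assms, of 0]
    by (simp add: cofactor_def numeral_3_eq_3 numeral_2_eq_2)
  ultimately show ?thesis by simp
qed

text \<open>In a diagonal form of a unimodular matrix the first entry divides every entry of the
  matrix, so it is a unit. Determinant 0 then makes the second entry vanish, leaving one column of
  \<open>P'\<close> times one row of \<open>Q'\<close>.\<close>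

lemma elementary_divisor_imp_rank_one:
  assumes "elementary_divisor_ring TYPE('a::comm_ring_1)"
  shows "rank_one_ring TYPE('a)"
  unfolding rank_one_ring_def
proof (intro allI impI, elim conjE exE)
  fix a b c d x y z w :: 'a
  assume det: "a * d = b * c" and unit: "a * x + b * y + c * z + d * w = 1"
  define A where "A = mat 2 2 (\<lambda>(i, j). if i = 0 then if j = 0 then a else b
    else if j = 0 then c else d)"
  have A: "A \<in> carrier_mat 2 2" by (simp add: A_def)
  have entries: "A $$ (0, 0) = a" "A $$ (0, 1) = b" "A $$ (1, 0) = c" "A $$ (1, 1) = d"
    by (simp_all add: A_def)
  have "\<exists>D. equivalent_mat A D \<and> diagonal_mat D \<and>
      (\<forall>i. i + 1 < min 2 2 \<longrightarrow> D $$ (i, i) dvd D $$ (i + 1, i + 1))"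
    using assms[unfolded elementary_divisor_ring_def, rule_format, of 2 2 A] A by simp
  then obtain D where "equivalent_mat A D" and diag: "diagonal_mat D"
    and dvd: "D $$ (0, 0) dvd D $$ (1, 1)" by fastforce
  then obtain P Q where P: "P \<in> GL 2" and Q: "Q \<in> GL 2" and D: "D = P * A * Q"
    using A by (auto elim: equivalent_matE)
  have Dc: "D \<in> carrier_mat 2 2"
    unfolding D by (rule mult_carrier_mat[OF mult_carrier_mat[OF GL_carrier[OF P] A] GL_carrier[OF Q]])
  obtain P' where P': "P' \<in> carrier_mat 2 2" "P' * P = 1\<^sub>m 2" using P by (rule GL_E)
  obtain Q' where Q': "Q' \<in> carrier_mat 2 2" "Q * Q' = 1\<^sub>m 2" using Q by (rule GL_E)
  note carr [simp] = A P'(1) Q'(1) GL_carrier[OF P] GL_carrier[OF Q] mult_carrier_mat[of _ 2 2 _ 2]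
  have "P' * D * Q' = (P' * P) * (A * (Q * Q'))"
    by (simp add: D assoc_mult_mat[of _ 2 2 _ 2 _ 2])
  then have A_eq: "A = P' * D * Q'" by (simp add: P' Q' left_mult_one_mat[OF A] right_mult_one_mat[OF A])
  have detA: "det A = 0" using det unfolding det_2_by_2[OF A] entries by simp
  have "det D = 0"
    using D detA by (simp add: det_mult[of _ 2])
  moreover have D01: "D $$ (0, 1) = 0" "D $$ (1, 0) = 0"
    using diag Dc by (auto simp: diagonal_mat_def)
  ultimately have D0: "D $$ (0, 0) * D $$ (1, 1) = 0"
    by (simp add: det_2_by_2[OF Dc])
  obtain \<delta> where \<delta>: "D $$ (1, 1) = D $$ (0, 0) * \<delta>" using dvd by (auto simp: dvd_def)
  \<comment> \<open>Since \<open>D\<close> is diagonal, \<open>P' * D * Q'\<close> is a sum of two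
    rank one matrices.\<close>
  have entry: "A $$ (i, j) = D $$ (0, 0) * (P' $$ (i, 0) * Q' $$ (0, j))
      + D $$ (1, 1) * (P' $$ (i, 1) * Q' $$ (1, j))"
    if "i < 2" "j < 2" for i j
    using that P'(1) Q'(1) Dc D01 unfolding A_eq
    by (simp add: scalar_prod_def numeral_2_eq_2 algebra_simps)
  have "D $$ (0, 0) dvd A $$ (i, j)" if "i < 2" "j < 2" for i j
    unfolding entry[OF that] \<delta> by (simp add: mult.assoc)
  from this[of 0 0] this[of 0 1] this[of 1 0] this[of 1 1]
  have "D $$ (0, 0) dvd a * x + b * y + c * z + d * w" by (simp add: A_def)
  then obtain \<epsilon> where \<epsilon>: "1 = D $$ (0, 0) * \<epsilon>" using unit by (auto simp: dvd_def)
  have "D $$ (1, 1) = D $$ (0, 0) * D $$ (1, 1) * \<epsilon>"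
    using \<epsilon> by (metis mult.assoc mult.commute mult_1)
  then have "D $$ (1, 1) = 0" using D0 by simp
  with entry have "A $$ (i, j) = (D $$ (0, 0) * P' $$ (i, 0)) * Q' $$ (0, j)" if "i < 2" "j < 2" for i j
    using that by (simp add: mult.assoc)
  from this[of 0 0] this[of 0 1] this[of 1 0] this[of 1 1]
  show "\<exists>u1 u2 v1 v2. a = u1 * v1 \<and> b = u1 * v2 \<and> c = u2 * v1 \<and> d = u2 * v2"
    by (auto simp: A_def)
qed

text \<open>Translates the ideal in the \<open>Pi2_ring\<close> condition into the scalar relation
  of \<open>rank_one_ring\<close>: linear combinations of the four entries form a submodule, which
  is the span.\<close>

lemma ideal_generated_elements_mat_2:
  fixes A :: "'a::comm_ring_1 mat"
  assumes A: "A \<in> carrier_mat 2 2"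
  shows "ideal_generated (elements_mat A) = UNIV \<longleftrightarrow>
    (\<exists>x y z w. A $$ (0, 0) * x + A $$ (0, 1) * y + A $$ (1, 0) * z + A $$ (1, 1) * w = 1)"
    (is "_ \<longleftrightarrow> ?R")
proof -
  let ?f = "\<lambda>x y z w. A $$ (0, 0) * x + A $$ (0, 1) * y + A $$ (1, 0) * z + A $$ (1, 1) * w"
  have f_add: "?f x y z w + ?f x' y' z' w' = ?f (x + x') (y + y') (z + z') (w + w')"
    and f_scale: "t * ?f x y z w = ?f (t * x) (t * y) (t * z) (t * w)" for t x y z w x' y' z' w'
    by (simp_all add: algebra_simps)
  interpret Modules.module "(*) :: 'a \<Rightarrow> 'a \<Rightarrow> 'a" by (rule module_over_itself)
  have el: "elements_mat A = {A $$ (0, 0), A $$ (0, 1), A $$ (1, 0), A $$ (1, 1)}"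
    using A by (auto simp: elements_mat_def numeral_2_eq_2)
  let ?T = "{r. \<exists>x y z w. r = ?f x y z w}"
  have "subspace ?T"
  proof (rule subspaceI)
    show "0 \<in> ?T" by (auto intro!: exI[of _ 0])
  next
    fix r s assume "r \<in> ?T" "s \<in> ?T"
    then obtain x y z w x' y' z' w' where "r = ?f x y z w" "s = ?f x' y' z' w'" by blast
    then show "r + s \<in> ?T" using f_add by blast
  next
    fix t r assume "r \<in> ?T"
    then obtain x y z w where "r = ?f x y z w" by blast
    then show "t * r \<in> ?T" using f_scale by blast
  qed
  moreover have "elements_mat A \<subseteq> ?T"
  proof -
    have "A $$ (0, 0) = ?f 1 0 0 0" "A $$ (0, 1) = ?f 0 1 0 0"
      "A $$ (1, 0) = ?f 0 0 1 0" "A $$ (1, 1) = ?f 0 0 0 1" by simp_all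
    then show ?thesis unfolding el by blast
  qed
  ultimately have sub: "span (elements_mat A) \<subseteq> ?T" by (intro span_minimal)
  have in_span: "?f x y z w \<in> span (elements_mat A)" for x y z w
  proof -
    have "x * A $$ (0, 0) + y * A $$ (0, 1) + z * A $$ (1, 0) + w * A $$ (1, 1)
      \<in> span (elements_mat A)"
      unfolding el by (intro span_add span_scale span_base) auto
    then show ?thesis by (simp add: mult.commute)
  qed
  show ?thesis unfolding ideal_generated_def
  proof
    assume "span (elements_mat A) = UNIV"
    then have "1 \<in> ?T" using sub by blast
    then obtain x y z w where "1 = ?f x y z w" by blast
    then show ?R by (intro exI) (rule sym)
  next
    assume ?R
    then obtain x y z w where "?f x y z w = 1" by blast
    with in_span[of x y z w] have 1: "1 \<in> span (elements_mat A)" by (simp only:)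
    have "r \<in> span (elements_mat A)" for r using span_scale[OF 1, of r] by (simp only: mult_1_right)
    then show "span (elements_mat A) = UNIV" by blast
  qed
qed

text \<open>
  The matrix \<open>u v\<^sup>T\<close> is bordered by a column and a row that pair to 1 with \<open>u\<close> and \<open>v\<close>,
  up to a rotation by a right angle.
\<close>

lemma rank_one_imp_Pi2:
  assumes "rank_one_ring TYPE('a::comm_ring_1)"
  shows "Pi2_ring TYPE('a)"
  unfolding Pi2_ring_def
proof (intro allI impI, elim conjE)
  fix A :: "'a mat"
  assume A: "A \<in> carrier_mat 2 2" and "ideal_generated (elements_mat A) = UNIV" and "det A = 0"
  then obtain x y z w
    where unit: "A $$ (0, 0) * x + A $$ (0, 1) * y + A $$ (1, 0) * z + A $$ (1, 1) * w = 1"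
    using ideal_generated_elements_mat_2[OF A] by blast
  have "A $$ (0, 0) * A $$ (1, 1) = A $$ (0, 1) * A $$ (1, 0)"
    using \<open>det A = 0\<close> by (simp add: det_2_by_2[OF A])
  then obtain u1 u2 v1 v2 where uv: "A $$ (0, 0) = u1 * v1" "A $$ (0, 1) = u1 * v2"
    "A $$ (1, 0) = u2 * v1" "A $$ (1, 1) = u2 * v2"
    by (rule rank_one_ringE[OF assms _ unit])
  \<comment> \<open>These regroup the unimodularity relation, once by the entries of u and once by
    those of v.\<close>
  define s1 s2 t1 t2 where "s1 = v1 * x + v2 * y" and "s2 = v1 * z + v2 * w"
    and "t1 = u1 * x + u2 * z" and "t2 = u1 * y + u2 * w"
  have us: "u1 * s1 + u2 * s2 = 1" and vt: "v1 * t1 + v2 * t2 = 1"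
    using unit unfolding uv by (simp_all add: s1_def s2_def t1_def t2_def algebra_simps)
  define B where "B = mat 3 3 (\<lambda>(i, j). if i < 2 \<and> j < 2 then A $$ (i, j)
    else if i = 0 then - s2 else if i = 1 then s1 else if j = 0 then t2
    else if j = 1 then - t1 else 0)"
  have B: "B \<in> carrier_mat 3 3" by (simp add: B_def)
  \<comment> \<open>With corner 0, \<open>det B\<close> is minus the new row times the adjugate of u
    v^T times the new column. That adjugate is \<open>(v2, - v1)\<close> as a column times
    \<open>(u2, - u1)\<close> as a row, so the determinant splits.\<close>
  have "det B = (u1 * s1 + u2 * s2) * (v1 * t1 + v2 * t2)"
    unfolding det_3_by_3[OF B] by (simp add: B_def uv[simplified] algebra_simps)
  then have "B \<in> SL 3" using B us vt by (simp add: SL_def)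
  moreover have "\<forall>i<2. \<forall>j<2. B $$ (i, j) = A $$ (i, j)" by (simp add: B_def)
  ultimately show "\<exists>B\<in>SL 3. \<forall>i<2. \<forall>j<2. B $$ (i, j) = A $$ (i, j)" by blast
qed

text \<open>
  The last diagonal entry of the inverse of the extension is the cofactor \<open>det A = 0\<close>, so the rest
  of its last column is a unimodular vector in the kernel of \<open>A\<close>.
\<close>

lemma Pi2_imp_rank_one:
  assumes "Pi2_ring TYPE('a::comm_ring_1)"
  shows "rank_one_ring TYPE('a)"
  unfolding rank_one_ring_def
proof (intro allI impI, elim conjE exE)
  fix a b c d x y z w :: 'a
  assume det: "a * d = b * c" and unit: "a * x + b * y + c * z + d * w = 1"
  define A where "A = mat 2 2 (\<lambda>(i, j). if i = 0 then if j = 0 then a else b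
    else if j = 0 then c else d)"
  have A: "A \<in> carrier_mat 2 2" by (simp add: A_def)
  have entries: "A $$ (0, 0) = a" "A $$ (0, 1) = b" "A $$ (1, 0) = c" "A $$ (1, 1) = d"
    by (simp_all add: A_def)
  have "det A = 0" using det unfolding det_2_by_2[OF A] entries by simp
  moreover have "ideal_generated (elements_mat A) = UNIV"
    using unit unfolding ideal_generated_elements_mat_2[OF A] entries by blast
  ultimately have "\<exists>B\<in>SL 3. \<forall>i<2. \<forall>j<2. B $$ (i, j) = A $$ (i, j)"
    using assms[unfolded Pi2_ring_def, rule_format, of A] A by simp
  then obtain B where B: "B \<in> carrier_mat 3 3" "det B = 1"
    and BA: "\<And>i j. i < 2 \<Longrightarrow> j < 2 \<Longrightarrow> B $$ (i, j) = A $$ (i, j)"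
    unfolding SL_def by blast
  have "mat_delete B 2 2 = A"
    using B A BA by (intro eq_matI) (auto simp: mat_delete_def)
  then have "cofactor B 2 2 = 0" using \<open>det A = 0\<close> by (simp add: cofactor_def)
  then have adj22: "adj_mat B $$ (2, 2) = 0" using B by (simp add: adj_mat_def)
  have "B * adj_mat B = 1\<^sub>m 3" using adj_mat(2)[OF B(1)] B(2) by (auto intro: eq_matI)
  then have prod: "(B * adj_mat B) $$ (i, 2) = (if i = 2 then 1 else 0)" if "i < 3" for i
    using that by simp
  have BC: "(B * adj_mat B) $$ (i, 2)
      = B $$ (i, 0) * adj_mat B $$ (0, 2) + B $$ (i, 1) * adj_mat B $$ (1, 2)" if "i < 3" for i
    using that B adj_mat(1)[OF B(1)] adj22
    by (simp add: scalar_prod_def numeral_3_eq_3 numeral_2_eq_2)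
  define k0 k1 r0 r1 where "k0 = adj_mat B $$ (0, 2)" and "k1 = adj_mat B $$ (1, 2)"
    and "r0 = B $$ (2, 0)" and "r1 = B $$ (2, 1)"
  have ker: "a * k0 + b * k1 = 0" "c * k0 + d * k1 = 0" and rk: "r0 * k0 + r1 * k1 = 1"
    using prod[of 0] prod[of 1] prod[of 2] BC[of 0] BC[of 1] BC[of 2] BA entries
    by (simp_all add: k0_def k1_def r0_def r1_def)
  \<comment> \<open>A row that kills the unimodular vector \<open>(k0, k1)\<close> is a multiple of
    \<open>(k1, - k0)\<close>; pairing with \<open>(r1, - r0)\<close> yields the multiplier. Both
    rows of \<open>A\<close> thus share the vector v \<open>= (k1, - k0)\<close>.\<close>
  have factor: "p = (p * r1 - q * r0) * k1 \<and> q = (p * r1 - q * r0) * (- k0)"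
    if "p * k0 + q * k1 = 0" for p q
  proof -
    have "(p * r1 - q * r0) * k1 = p * (r0 * k0 + r1 * k1) - r0 * (p * k0 + q * k1)"
      and "(p * r1 - q * r0) * (- k0) = q * (r0 * k0 + r1 * k1) - r1 * (p * k0 + q * k1)"
      by (simp_all add: algebra_simps)
    then show ?thesis using that rk by simp
  qed
  from factor[OF ker(1)] factor[OF ker(2)]
  show "\<exists>u1 u2 v1 v2. a = u1 * v1 \<and> b = u1 * v2 \<and> c = u2 * v1 \<and> d = u2 * v2" by blast
qed

theorem corollary1p16:
  assumes "J21_ring TYPE('a::comm_ring_1)"
  shows "(elementary_divisor_ring TYPE('a) \<longleftrightarrow> Pi2_ring TYPE('a)) \<and>
         (integral_domain TYPE('a) \<longrightarrow> elementary_divisor_ring TYPE('a))"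
proof -
  note H = J21_imp_hermite[OF assms]
  have "elementary_divisor_ring TYPE('a)" if "rank_one_ring TYPE('a)"
    using that by (intro hermite_bilinear_unit_imp_elementary_divisor[OF H]
        J21_rank_one_imp_bilinear_unit[OF assms])
  then show ?thesis
    using Pi2_imp_rank_one rank_one_imp_Pi2 elementary_divisor_imp_rank_one
      integral_domain_hermite_imp_rank_one[OF _ H] by blast
qed

end
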